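(* Let $\Gamma$ be a countable directed graph, $F:\Gamma_{Ar}\to\mathbb R$ a potential and $\beta\in\mathbb R$. Assume that there is a vertex $v_0\in\Gamma_V$ such that $0<\sum_{n=0}^\infty A(\beta)^n_{v_0,v}<\infty$ for all $v\in\Gamma_V$. Let $m$ be an $e^{\beta F}$-conformal measure on $P(\Gamma)$. The following are equivalent: a) There is a ray $p\in\mathrm{Ray}(\Gamma)$ such that $m$ is concentrated on $$\Big\{q\in\mathrm{Wan}(\Gamma):\ \lim_{k\to\infty}K_\beta(v,s(q_k))=\lim_{k\to\infty}K_\beta(v,s(p_k))\ \ \forall v\in\Gamma_V\Big\}.$$ b) $m$ is concentrated on $$\Big\{q\in P(\Gamma):\ \lim_{k\to\infty}K_\beta(v,s(q_k))=\frac{m(Z(v))}{m(Z(v_0))}\ \ \forall v\in\Gamma_V\Big\}.$$ c) $m$ is extremal among the $e^{\beta F}$-conformal measures on $P(\Gamma)$. d) $m$ is ergodic for the shift on $P(\Gamma)$.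
   Context: A countable directed graph $\Gamma$ consists of countable sets $\Gamma_V$ (vertices) and $\Gamma_{Ar}$ (arrows) with source and range maps $s,r:\Gamma_{Ar}\to\Gamma_V$ (multiple arrows and loops allowed). $P(\Gamma)$ is the set of infinite paths $p=(p_i)_{i\ge1}\in(\Gamma_{Ar})^{\mathbb N}$, $r(p_i)=s(p_{i+1})$, with the topology inherited from the product of discrete spaces; $Z(v)=\{p:s(p_1)=v\}$, $Z(a)=\{p:p_1=a\}$ for $a\in\Gamma_{Ar}$; the shift is $\sigma(p)_i=p_{i+1}$. $\mathrm{Ray}(\Gamma)$ is the set of infinite paths with the vertices $s(p_i)$ distinct. $\mathrm{Wan}(\Gamma)$ is the set of $p\in P(\Gamma)$ such that for each finite $H\subseteq\Gamma_V$ there is $N$ with $s(p_i)\notin H$ for all $i\ge N$. $A(\beta)_{v,w}=\sum_{a\in s^{-1}(v)\cap r^{-1}(w)}e^{-\beta F(a)}\in[0,\infty]$, with matrix powers $A(\beta)^n$, $A(\beta)^0$ the identity. The Martin kernel is $K_\beta(v,w)=\dfrac{\sum_{n=0}^\infty A(\beta)^n_{v,w}}{\sum_{n=0}^\infty A(\beta)^n_{v_0,w}}$. In a) and b) the equality of limits includes the requirement that the limits exist. A non-zero Borel measure $m$ on $P(\Gamma)$ with $m(Z(v))<\infty$ for all $v$ is $e^{\beta F}$-conformal if $m(\sigma(B\cap Z(a)))=e^{\beta F(a)}m(B\cap Z(a))$ for all arrows $a$ and Borel sets $B$. It is concentrated on a Borel set $B$ if $m(P(\Gamma)\setminus B)=0$;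 extremal if every $e^{\beta F}$-conformal measure $m'\le m$ is of the form $\lambda m$, $\lambda>0$; ergodic for the shift if every Borel set $B$ with $\sigma^{-1}(B)=B$ satisfies $m(B)=0$ or $m(P(\Gamma)\setminus B)=0$. *)

theory Defs
  imports "HOL-Analysis.Analysis" "Graph_Theory.Digraph"
begin

text \<open>
  Infinite paths are indexed from \<open>0\<close>: the arrow \<open>p\<^sub>i\<close> (\<open>i \<ge> 1\<close>) of the usual notation is \<open>p (i - 1)\<close>.
\<close>

definition inf_paths :: "('v, 'a) pre_digraph \<Rightarrow> (nat \<Rightarrow> 'a) set" where
  "inf_paths G = {p. (\<forall>i. p i \<in> arcs G) \<and> (\<forall>i. head G (p i) = tail G (p (Suc i)))}"

definition path_topology :: "('v, 'a) pre_digraph \<Rightarrow> (nat \<Rightarrow> 'a) topology" where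
  "path_topology G =
     subtopology (product_topology (\<lambda>_. discrete_topology (arcs G)) UNIV) (inf_paths G)"

definition path_borel :: "('v, 'a) pre_digraph \<Rightarrow> (nat \<Rightarrow> 'a) measure" where
  "path_borel G = sigma (inf_paths G) {U. openin (path_topology G) U}"

definition vertex_cyl :: "('v, 'a) pre_digraph \<Rightarrow> 'v \<Rightarrow> (nat \<Rightarrow> 'a) set" where
  "vertex_cyl G v = {p \<in> inf_paths G. tail G (p 0) = v}"

definition arrow_cyl :: "('v, 'a) pre_digraph \<Rightarrow> 'a \<Rightarrow> (nat \<Rightarrow> 'a) set" where
  "arrow_cyl G a = {p \<in> inf_paths G. p 0 = a}"

definition path_shift :: "(nat \<Rightarrow> 'a) \<Rightarrow> nat \<Rightarrow> 'a" where
  "path_shift p = (\<lambda>i. p (Suc i))"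

definition rays :: "('v, 'a) pre_digraph \<Rightarrow> (nat \<Rightarrow> 'a) set" where
  "rays G = {p \<in> inf_paths G. inj (\<lambda>i. tail G (p i))}"

definition wandering :: "('v, 'a) pre_digraph \<Rightarrow> (nat \<Rightarrow> 'a) set" where
  "wandering G = {p \<in> inf_paths G.
     \<forall>H. finite H \<and> H \<subseteq> verts G \<longrightarrow> (\<exists>N. \<forall>i\<ge>N. tail G (p i) \<notin> H)}"

text \<open>
  Possibly infinite sums in \<open>[0,\<infinity>]\<close> over a set are written as integrals with respect to
  counting measure; products use the convention \<open>0 \<cdot> \<infinity> = 0\<close> of \<^typ>\<open>ennreal\<close>.
\<close>

definition arrow_matrix ::
    "('v, 'a) pre_digraph \<Rightarrow> ('a \<Rightarrow> real) \<Rightarrow> real \<Rightarrow> 'v \<Rightarrow> 'v \<Rightarrow> ennreal" where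
  "arrow_matrix G F \<beta> v w =
     (\<integral>\<^sup>+a. ennreal (exp (- \<beta> * F a)) \<partial>count_space {a \<in> arcs G. tail G a = v \<and> head G a = w})"

primrec arrow_matrix_pow ::
    "('v, 'a) pre_digraph \<Rightarrow> ('a \<Rightarrow> real) \<Rightarrow> real \<Rightarrow> nat \<Rightarrow> 'v \<Rightarrow> 'v \<Rightarrow> ennreal" where
  "arrow_matrix_pow G F \<beta> 0 = (\<lambda>v w. if v = w then 1 else 0)"
| "arrow_matrix_pow G F \<beta> (Suc n) =
     (\<lambda>v w. \<integral>\<^sup>+u. arrow_matrix G F \<beta> v u * arrow_matrix_pow G F \<beta> n u w \<partial>count_space (verts G))"

definition green ::
    "('v, 'a) pre_digraph \<Rightarrow> ('a \<Rightarrow> real) \<Rightarrow> real \<Rightarrow> 'v \<Rightarrow> 'v \<Rightarrow> ennreal" where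
  "green G F \<beta> v w = (\<Sum>n. arrow_matrix_pow G F \<beta> n v w)"

text \<open>
  If \<open>0 < green G F \<beta> v\<^sub>0 w < \<infinity>\<close> for all \<open>w\<close>, then for fixed \<open>v\<close> the kernel is bounded in \<open>w\<close> by
  a finite constant (\<open>1 / arrow_matrix_pow G F \<beta> n v\<^sub>0 v\<close> for any \<open>n\<close> making this entry
  positive), so convergence in \<^typ>\<open>ennreal\<close> is convergence to a real number.
\<close>

definition martin_kernel ::
    "('v, 'a) pre_digraph \<Rightarrow> ('a \<Rightarrow> real) \<Rightarrow> real \<Rightarrow> 'v \<Rightarrow> 'v \<Rightarrow> 'v \<Rightarrow> ennreal" where
  "martin_kernel G F \<beta> v0 v w = green G F \<beta> v w / green G F \<beta> v0 w"

definition conformal ::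
    "('v, 'a) pre_digraph \<Rightarrow> ('a \<Rightarrow> real) \<Rightarrow> real \<Rightarrow> (nat \<Rightarrow> 'a) measure \<Rightarrow> bool" where
  "conformal G F \<beta> m \<longleftrightarrow>
     sets m = sets (path_borel G) \<and>
     emeasure m (inf_paths G) \<noteq> 0 \<and>
     (\<forall>v\<in>verts G. emeasure m (vertex_cyl G v) < \<infinity>) \<and>
     (\<forall>a\<in>arcs G. \<forall>B\<in>sets (path_borel G).
        emeasure m (path_shift ` (B \<inter> arrow_cyl G a)) =
          ennreal (exp (\<beta> * F a)) * emeasure m (B \<inter> arrow_cyl G a))"

text \<open>
  Measurability of \<open>B\<close> is part of the notion: \<^const>\<open>emeasure\<close> vanishes on non-measurable sets.
\<close>

definition concentrated_on :: "'x measure \<Rightarrow> 'x set \<Rightarrow> bool" where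
  "concentrated_on m B \<longleftrightarrow> B \<in> sets m \<and> emeasure m (space m - B) = 0"

definition extremal_conformal ::
    "('v, 'a) pre_digraph \<Rightarrow> ('a \<Rightarrow> real) \<Rightarrow> real \<Rightarrow> (nat \<Rightarrow> 'a) measure \<Rightarrow> bool" where
  "extremal_conformal G F \<beta> m \<longleftrightarrow>
     conformal G F \<beta> m \<and>
     (\<forall>m'. conformal G F \<beta> m' \<and> (\<forall>B\<in>sets (path_borel G). emeasure m' B \<le> emeasure m B) \<longrightarrow>
        (\<exists>c::real. c > 0 \<and> m' = scale_measure (ennreal c) m))"

definition shift_ergodic :: "('v, 'a) pre_digraph \<Rightarrow> (nat \<Rightarrow> 'a) measure \<Rightarrow> bool" where
  "shift_ergodic G m \<longleftrightarrow>
     (\<forall>B\<in>sets (path_borel G). path_shift -` B \<inter> inf_paths G = B \<longrightarrow>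
        emeasure m B = 0 \<or> emeasure m (inf_paths G - B) = 0)"

end

theory Submission
  imports Defs
begin

text \<open>
  Write \<open>m\<^sub>v\<close> for the mass of the paths starting at \<open>v\<close>, \<open>K\<close> for the Martin kernel and
  \<open>t\<^sub>v = m\<^sub>v / m\<^bsub>v0\<^esub>\<close>. Everything rests on comparing how much mass of the paths from two
  vertices meets a given set of vertices.

  Conformality says that inserting a finite path in front of the paths in a set multiplies its
  measure by the weight of that path. Summing weights, the paths from \<open>v\<close> whose
  \<open>n\<close>-th tail lies in a set \<open>T\<close> of paths starting at \<open>w\<close> have measure \<open>A\<^sup>n\<^bsub>v,w\<^esub> m(T)\<close>
  (\<open>emeasure_funpow_pullback\<close>). As the Green kernel is finite, the Borel--Cantelli lemma shows
  that almost every path eventually leaves every finite set of vertices \<open>H\<close>, so a path that meets \<open>H\<close> does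
  so for a last time. Splitting at the last visit gives
  \<open>m {q from u meeting H} = (\<Sum>w\<in>H. G(u,w) * e\<^sub>H(w))\<close>,
  where \<open>G\<close> is the Green kernel and the weight \<open>e\<^sub>H(w)\<close> does not depend on the starting vertex
  \<open>u\<close> (\<open>emeasure_hitting_finite_set\<close>). Hence an inequality between \<open>G(u,w)\<close> and \<open>G(u',w)\<close> that
  holds for all \<open>w\<close> in a set \<open>W\<close> passes to the masses of the paths from \<open>u\<close> and from \<open>u'\<close> that
  meet \<open>W\<close>; by exhaustion \<open>W\<close> may be infinite. In particular, if almost every path meets \<open>W\<close>
  and \<open>K(v,\<cdot>) \<ge> c\<close> on \<open>W\<close>, then \<open>t\<^sub>v \<ge> c\<close>, and likewise with \<open>\<le>\<close> (\<open>mass_ratio_bounds\<close>).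

  The equivalences follow. If \<open>K(v,s(q\<^sub>k))\<close> converges almost everywhere to a constant, then this
  constant is \<open>t\<^sub>v\<close>, which gives b) from a). If b) holds for \<open>m\<close> and \<open>m' \<le> m\<close> is conformal, the
  limits are the same \<open>m'\<close>-almost everywhere, so \<open>m\<close> and \<open>m'\<close> have the same ratios \<open>t\<^sub>v\<close>; since a
  conformal measure is determined by the numbers \<open>m\<^sub>v\<close>, the two are proportional, which is c).
  From c) to d) one restricts \<open>m\<close> to an invariant set. If \<open>m\<close> is ergodic and \<open>c > t\<^sub>v\<close>, then
  visiting \<open>{w. K(v,w) \<ge> c}\<close> infinitely often is an invariant event; it does not have full measure,
  because otherwise \<open>t\<^sub>v \<ge> c\<close>, so it is null. With the symmetric statement for \<open>c < t\<^sub>v\<close> this is b).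
  Finally, a wandering path of b) contains a ray through a subsequence of its vertices, which
  gives a).
\<close>

lemma concentrated_on_iff_AE: "concentrated_on M B \<longleftrightarrow> B \<in> sets M \<and> (AE x in M. x \<in> B)"
proof (cases "B \<in> sets M")
  case True
  have eq: "{x \<in> space M. x \<notin> B} = space M - B" by auto
  have N: "space M - B \<in> sets M" using True by auto
  then have "(AE x in M. x \<in> B) \<longleftrightarrow> space M - B \<in> null_sets M"
    using AE_iff_null[of M "\<lambda>x. x \<in> B"] by (simp add: eq)
  then show ?thesis
    using True N by (simp add: concentrated_on_def null_sets_def)
qed (simp add: concentrated_on_def)

lemma ennreal_divide_le_iff:
  fixes x y c :: ennreal
  assumes "0 < y" "y < \<infinity>"
  shows "x / y \<le> c \<longleftrightarrow> x \<le> c * y" and "c \<le> x / y \<longleftrightarrow> c * y \<le> x"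
proof -
  show "c \<le> x / y \<longleftrightarrow> c * y \<le> x"
    using divide_less_ennreal[of y x c] assms by (simp add: not_less[symmetric])
  have "x / y * y = x"
    using assms by (simp add: ennreal_divide_times)
  then show "x / y \<le> c \<longleftrightarrow> x \<le> c * y"
    using divide_le_posI_ennreal[of y x c] assms(1) mult_right_mono[of "x / y" c y]
    by (auto simp: mult.commute)
qed

section \<open>The Borel structure of the path space\<close>

text \<open>
  Words over the arrows are countable in number, so every open set of paths is a countable union of
  these cylinders.
\<close>

definition word_cyl :: "('v, 'a) pre_digraph \<Rightarrow> 'a list \<Rightarrow> (nat \<Rightarrow> 'a) set" where
  "word_cyl G l = {q \<in> inf_paths G. \<forall>i<length l. q i = l ! i}"

locale countable_digraph = wf_digraph G for G :: "('v, 'a) pre_digraph" +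
  assumes countable_verts: "countable (verts G)"
    and countable_arcs: "countable (arcs G)"
begin

lemma inf_paths_arc: "q \<in> inf_paths G \<Longrightarrow> q i \<in> arcs G"
  by (simp add: inf_paths_def)

lemma inf_paths_head: "q \<in> inf_paths G \<Longrightarrow> head G (q i) = tail G (q (Suc i))"
  by (simp add: inf_paths_def)

lemma inf_paths_tail: "q \<in> inf_paths G \<Longrightarrow> tail G (q i) \<in> verts G"
  by (simp add: inf_paths_arc)

lemma path_shift_inf_paths: "q \<in> inf_paths G \<Longrightarrow> path_shift q \<in> inf_paths G"
  by (simp add: inf_paths_def path_shift_def)

lemma inf_paths_Cons:
  "a \<in> arcs G \<Longrightarrow> q \<in> inf_paths G \<Longrightarrow> tail G (q 0) = head G a \<Longrightarrow> case_nat a q \<in> inf_paths G"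
  by (auto simp: inf_paths_def split: nat.split)

lemma path_shift_apply: "path_shift q i = q (Suc i)"
  by (simp add: path_shift_def)

lemma path_shift_funpow: "(path_shift ^^ n) q i = q (n + i)"
  by (induction n arbitrary: i) (auto simp: path_shift_def)

lemma path_shift_funpow_inf_paths: "q \<in> inf_paths G \<Longrightarrow> (path_shift ^^ n) q \<in> inf_paths G"
  by (induction n) (auto simp: path_shift_inf_paths)

lemma topspace_path_topology: "topspace (path_topology G) = inf_paths G"
  by (auto simp: path_topology_def inf_paths_def)

lemma space_path_borel [simp]: "space (path_borel G) = inf_paths G"
  unfolding path_borel_def
  by (rule space_measure_of) (use openin_subset[of "path_topology G"] in \<open>auto simp: topspace_path_topology\<close>)

lemma openin_word_cyl: "openin (path_topology G) (word_cyl G l)"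
proof -
  let ?X = "\<lambda>i. if i < length l then {l ! i} \<inter> arcs G else arcs G"
  have "openin (product_topology (\<lambda>_. discrete_topology (arcs G)) UNIV) (PiE UNIV ?X)"
    unfolding openin_PiE_gen
  proof (intro disjI2 conjI ballI)
    show "finite {i \<in> UNIV. ?X i \<noteq> topspace (discrete_topology (arcs G))}"
      by (rule finite_subset[of _ "{..<length l}"]) auto
  qed simp
  moreover have "word_cyl G l = PiE UNIV ?X \<inter> inf_paths G"
    by (auto simp: word_cyl_def PiE_iff split: if_splits) (metis inf_paths_arc)+
  ultimately show ?thesis
    unfolding path_topology_def openin_subtopology by blast
qed

lemma word_cyl_neighbourhood:
  assumes "openin (path_topology G) U" "q \<in> U"
  obtains l where "l \<in> lists (arcs G)" "l \<noteq> []" "q \<in> word_cyl G l" "word_cyl G l \<subseteq> U"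
proof -
  obtain T where T: "openin (product_topology (\<lambda>_. discrete_topology (arcs G)) UNIV) T"
      and U: "U = T \<inter> inf_paths G"
    using assms(1) unfolding path_topology_def openin_subtopology by blast
  obtain X where X: "q \<in> PiE UNIV X" "finite {i. X i \<noteq> arcs G}" "PiE UNIV X \<subseteq> T"
    using product_topology_open_contains_basis[OF T, of q] assms(2) unfolding U by auto
  obtain n where n: "\<And>i. X i \<noteq> arcs G \<Longrightarrow> i < n"
    using X(2) finite_nat_set_iff_bounded by auto
  have q: "q \<in> inf_paths G"
    using assms(2) U by blast
  let ?l = "map q [0..<Suc n]"
  have "word_cyl G ?l \<subseteq> PiE UNIV X"
  proof
    fix p assume p: "p \<in> word_cyl G ?l"
    have "p i \<in> X i" for i
    proof (cases "i < n")
      case True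
      then have "p i = q i"
        using p by (auto simp: word_cyl_def simp del: upt_Suc)
      then show ?thesis using X(1) by auto
    next
      case False
      then have "X i = arcs G" using n by blast
      then show ?thesis using p by (simp add: word_cyl_def inf_paths_arc)
    qed
    then show "p \<in> PiE UNIV X" by auto
  qed
  moreover have "word_cyl G ?l \<subseteq> inf_paths G"
    by (auto simp: word_cyl_def)
  ultimately have "word_cyl G ?l \<subseteq> U"
    using X(3) U by blast
  moreover have "q \<in> word_cyl G ?l"
    using q by (auto simp: word_cyl_def simp del: upt_Suc)
  moreover have "?l \<in> lists (arcs G)" "?l \<noteq> []"
    using q by (auto simp: inf_paths_arc)
  ultimately show thesis by (intro that)
qed

text \<open>
  The generator leaves out the empty word: a cylinder over a nonempty word is
  contained in some \<^const>\<open>vertex_cyl\<close>, so conformal measures are finite on it. The empty set is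
  added to make the generator closed under intersections.
\<close>

lemma sets_path_borel:
  "sets (path_borel G) = sigma_sets (inf_paths G) (insert {} (word_cyl G ` {l. l \<noteq> []}))"
  (is "_ = sigma_sets _ ?E")
proof -
  have E: "?E \<subseteq> Pow (inf_paths G)"
    by (auto simp: word_cyl_def)
  have "sets (path_borel G) = sigma_sets (inf_paths G) {U. openin (path_topology G) U}"
    unfolding path_borel_def
    by (rule sets_measure_of) (use openin_subset[of "path_topology G"] in \<open>auto simp: topspace_path_topology\<close>)
  also have "\<dots> = sigma_sets (inf_paths G) ?E"
  proof (rule sigma_sets_eqI)
    fix U assume "U \<in> {U. openin (path_topology G) U}"
    then have U: "openin (path_topology G) U" by simp
    let ?L = "{l \<in> lists (arcs G). l \<noteq> [] \<and> word_cyl G l \<subseteq> U}"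
    have "U = (\<Union>l\<in>?L. word_cyl G l)"
    proof
      show "U \<subseteq> (\<Union>l\<in>?L. word_cyl G l)"
      proof
        fix q assume "q \<in> U"
        then obtain l where "l \<in> ?L" "q \<in> word_cyl G l"
          using word_cyl_neighbourhood[OF U] by (metis (mono_tags, lifting) mem_Collect_eq)
        then show "q \<in> (\<Union>l\<in>?L. word_cyl G l)" by (rule UN_I)
      qed
    qed (auto simp del: in_lists_conv_set)
    moreover have "countable ?L"
      using countable_lists[OF countable_arcs] by (rule countable_subset[rotated]) auto
    moreover have "(\<Union>l\<in>?L. word_cyl G l) \<in> sigma_sets (inf_paths G) ?E"
      if "countable ?L"
    proof -
      interpret S: sigma_algebra "inf_paths G" "sigma_sets (inf_paths G) ?E"
        by (rule sigma_algebra_sigma_sets[OF E])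
      show ?thesis
        using that by (intro S.countable_UN') auto
    qed
    ultimately show "U \<in> sigma_sets (inf_paths G) ?E" by simp
  next
    fix U assume "U \<in> ?E"
    then have "openin (path_topology G) U"
      using openin_word_cyl by auto
    then show "U \<in> sigma_sets (inf_paths G) {U. openin (path_topology G) U}"
      by auto
  qed
  finally show ?thesis .
qed

lemma word_cyl_Cons:
  "word_cyl G (a # l) = {q \<in> inf_paths G. q 0 = a \<and> path_shift q \<in> word_cyl G l}"
proof -
  have "(\<forall>i<Suc (length l). q i = (a # l) ! i) \<longleftrightarrow> q 0 = a \<and> (\<forall>i<length l. path_shift q i = l ! i)"
    for q :: "nat \<Rightarrow> 'a"
    by (auto simp: All_less_Suc2 path_shift_def)
  then show ?thesis
    by (auto simp: word_cyl_def path_shift_inf_paths)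
qed

lemma word_cyl_sets [measurable]: "word_cyl G l \<in> sets (path_borel G)"
proof (cases "l = []")
  case True
  then have "word_cyl G l = space (path_borel G)" by (simp add: word_cyl_def)
  then show ?thesis by (metis sets.top)
next
  case False
  then show ?thesis unfolding sets_path_borel by auto
qed

lemma measurable_path_shift [measurable]: "path_shift \<in> measurable (path_borel G) (path_borel G)"
proof (rule measurable_sigma_sets[OF sets_path_borel])
  show "insert {} (word_cyl G ` {l. l \<noteq> []}) \<subseteq> Pow (inf_paths G)"
    by (auto simp: word_cyl_def)
  show "path_shift \<in> space (path_borel G) \<rightarrow> inf_paths G"
    by (auto simp: path_shift_inf_paths)
  fix Y assume "Y \<in> insert {} (word_cyl G ` {l. l \<noteq> []})"
  then consider "Y = {}" | l where "Y = word_cyl G l" by auto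
  then show "path_shift -` Y \<inter> space (path_borel G) \<in> sets (path_borel G)"
  proof cases
    case (2 l)
    have "path_shift -` Y \<inter> space (path_borel G) = (\<Union>a\<in>arcs G. word_cyl G (a # l))"
      unfolding 2
      using inf_paths_arc[of _ 0] by (auto simp: word_cyl_Cons)
    then show ?thesis
      by (auto intro!: sets.countable_UN' simp: countable_arcs)
  qed simp
qed

lemma measurable_path_arc [measurable]:
  "(\<lambda>q. q n) \<in> measurable (path_borel G) (count_space (arcs G))"
proof (induction n)
  case 0
  show ?case
  proof (subst measurable_count_space_eq_countable[OF countable_arcs], safe)
    fix a
    have "(\<lambda>q. q 0) -` {a} \<inter> space (path_borel G) = word_cyl G [a]"
      by (auto simp: word_cyl_def)
    then show "(\<lambda>q. q 0) -` {a} \<inter> space (path_borel G) \<in> sets (path_borel G)"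
      by simp
  qed (auto simp: inf_paths_arc)
next
  case (Suc n)
  show ?case
    using measurable_compose[OF measurable_path_shift Suc] by (simp add: path_shift_def)
qed

lemma measurable_path_vertex [measurable]:
  "(\<lambda>q. tail G (q n)) \<in> measurable (path_borel G) (count_space (verts G))"
  by (rule measurable_compose[OF measurable_path_arc]) auto

lemma measurable_path_vertex_in [measurable]:
  "Measurable.pred (path_borel G) (\<lambda>q. tail G (q n) \<in> W)"
  by (rule measurable_compose[OF measurable_path_vertex]) simp

lemma vertex_cyl_sets [measurable]: "vertex_cyl G v \<in> sets (path_borel G)"
proof -
  have "{q \<in> space (path_borel G). tail G (q 0) \<in> {v}} \<in> sets (path_borel G)"
    by measurable
  then show ?thesis by (simp add: vertex_cyl_def)
qed

lemma arrow_cyl_eq_word_cyl: "arrow_cyl G a = word_cyl G [a]"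
  by (auto simp: arrow_cyl_def word_cyl_def)

lemma inf_paths_eq_UN_vertex_cyl: "inf_paths G = (\<Union>v\<in>verts G. vertex_cyl G v)"
  by (auto simp: vertex_cyl_def inf_paths_tail)

text \<open>
  The sets on the left of the conformality condition are Borel sets, by induction over the
  \<open>\<sigma>\<close>-algebra. Complements cause no trouble because the shift is injective
  on paths with a given first arrow.
\<close>

lemma path_shift_image_sets:
  assumes "B \<in> sets (path_borel G)"
  shows "path_shift ` (B \<inter> arrow_cyl G a) \<in> sets (path_borel G)"
  using assms unfolding sets_path_borel
proof (induction rule: sigma_sets.induct)
  case (Basic B)
  then consider "B = {}" | b l where "B = word_cyl G (b # l)"
    by (auto simp: neq_Nil_conv)
  then show ?case
  proof cases
    case (2 b l)
    show ?thesis
    proof (cases "a = b \<and> a \<in> arcs G")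
      case True
      have "path_shift ` (B \<inter> arrow_cyl G a) = word_cyl G l \<inter> vertex_cyl G (head G a)"
      proof (intro equalityI subsetI)
        fix q assume q: "q \<in> word_cyl G l \<inter> vertex_cyl G (head G a)"
        then have "case_nat a q \<in> B \<inter> arrow_cyl G a"
          using True 2 inf_paths_Cons[of a q]
          by (auto simp: word_cyl_def vertex_cyl_def arrow_cyl_def nth_Cons split: nat.split)
        then show "q \<in> path_shift ` (B \<inter> arrow_cyl G a)"
          by (rule rev_image_eqI) (simp add: path_shift_def)
      next
        fix q assume "q \<in> path_shift ` (B \<inter> arrow_cyl G a)"
        then obtain p where "p \<in> B \<inter> arrow_cyl G a" "q = path_shift p" by blast
        then show "q \<in> word_cyl G l \<inter> vertex_cyl G (head G a)"
          using 2 path_shift_inf_paths[of p] inf_paths_head[of p 0]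
          by (auto simp: word_cyl_def vertex_cyl_def arrow_cyl_def path_shift_def)
      qed
      then show ?thesis
        unfolding sets_path_borel[symmetric] by simp
    next
      case False
      then have "B \<inter> arrow_cyl G a = {}"
        using 2 inf_paths_arc[of _ 0] by (auto simp: word_cyl_Cons arrow_cyl_def)
      then show ?thesis by (simp add: sigma_sets.Empty)
    qed
  qed (simp add: sigma_sets.Empty)
next
  case Empty
  then show ?case by (simp add: sigma_sets.Empty)
next
  case (Compl B)
  have "inj_on path_shift (arrow_cyl G a)"
  proof (rule inj_onI)
    fix p q assume "p \<in> arrow_cyl G a" "q \<in> arrow_cyl G a" "path_shift p = path_shift q"
    then have "p i = q i" for i
      by (cases i) (auto simp: arrow_cyl_def path_shift_def fun_eq_iff)
    then show "p = q" by blast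
  qed
  then have "path_shift ` ((inf_paths G - B) \<inter> arrow_cyl G a) =
      path_shift ` arrow_cyl G a - path_shift ` (B \<inter> arrow_cyl G a)"
    by (auto simp: inj_on_def arrow_cyl_def)
  moreover have "path_shift ` arrow_cyl G a \<in> sets (path_borel G)"
  proof (cases "a \<in> arcs G")
    case True
    have "path_shift ` arrow_cyl G a = vertex_cyl G (head G a)"
    proof (intro equalityI subsetI)
      fix q assume "q \<in> vertex_cyl G (head G a)"
      then have "case_nat a q \<in> arrow_cyl G a"
        using True inf_paths_Cons[of a q] by (auto simp: vertex_cyl_def arrow_cyl_def)
      then show "q \<in> path_shift ` arrow_cyl G a"
        by (rule rev_image_eqI) (simp add: path_shift_def)
    qed (use path_shift_inf_paths inf_paths_head[of _ 0] in
      \<open>auto simp: vertex_cyl_def arrow_cyl_def path_shift_def\<close>)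
    then show ?thesis by simp
  next
    case False
    then have "arrow_cyl G a = {}" by (auto simp: arrow_cyl_def inf_paths_arc)
    then show ?thesis by simp
  qed
  ultimately show ?case
    using Compl.IH unfolding sets_path_borel[symmetric] by (auto intro: sets.Diff)
next
  case (Union B)
  have "path_shift ` ((\<Union>i. B i) \<inter> arrow_cyl G a) = (\<Union>i. path_shift ` (B i \<inter> arrow_cyl G a))"
    by blast
  then show ?case
    using Union.IH by (auto intro: sigma_sets.Union)
qed

end

section \<open>Wandering paths and rays\<close>

context countable_digraph
begin

lemma wandering_iff:
  "q \<in> wandering G \<longleftrightarrow> q \<in> inf_paths G \<and> (\<forall>w\<in>verts G. \<forall>\<^sub>F n in sequentially. tail G (q n) \<noteq> w)"
proof -
  have "(\<forall>H. finite H \<and> H \<subseteq> verts G \<longrightarrow> (\<exists>N. \<forall>i\<ge>N. tail G (q i) \<notin> H)) \<longleftrightarrow>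
      (\<forall>w\<in>verts G. \<forall>\<^sub>F n in sequentially. tail G (q n) \<noteq> w)" (is "?L \<longleftrightarrow> ?R")
  proof
    assume L: ?L
    show ?R
    proof
      fix w assume "w \<in> verts G"
      then have "\<exists>N. \<forall>i\<ge>N. tail G (q i) \<notin> {w}" using L[rule_format, of "{w}"] by simp
      then show "\<forall>\<^sub>F n in sequentially. tail G (q n) \<noteq> w"
        by (simp add: eventually_sequentially)
    qed
  next
    assume R: ?R
    show ?L
    proof (intro allI impI)
      fix H assume H: "finite H \<and> H \<subseteq> verts G"
      then have "\<forall>\<^sub>F n in sequentially. \<forall>w\<in>H. tail G (q n) \<noteq> w"
        using R by (intro eventually_ball_finite) auto
      then show "\<exists>N. \<forall>i\<ge>N. tail G (q i) \<notin> H"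
        by (auto simp: eventually_sequentially)
    qed
  qed
  then show ?thesis by (simp add: wandering_def)
qed

text \<open>
  Loop erasure: take the arrow by which \<open>q\<close> leaves its initial vertex for the last time, then the
  arrow by which \<open>q\<close> leaves the range of that arrow for the last time, and so on. No vertex repeats,
  and the vertices of the ray form a subsequence of those of \<open>q\<close>.
\<close>

lemma ray_along_wandering_path:
  assumes q: "q \<in> wandering G"
  obtains p where "p \<in> rays G" and "\<And>f :: 'v \<Rightarrow> 'b::topological_space. \<And>L.
    (\<lambda>k. f (tail G (q k))) \<longlonglongrightarrow> L \<Longrightarrow> (\<lambda>k. f (tail G (p k))) \<longlonglongrightarrow> L"
proof -
  have qp: "q \<in> inf_paths G" using q by (simp add: wandering_def)
  define last where "last i = Max {k. tail G (q k) = tail G (q i)}" for i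
  have fin: "finite {k. tail G (q k) = tail G (q i)}" for i
  proof -
    have "\<exists>N. \<forall>k\<ge>N. tail G (q k) \<notin> {tail G (q i)}"
      using q inf_paths_tail[OF qp, of i] unfolding wandering_def by blast
    then obtain N where "\<And>k. k \<ge> N \<Longrightarrow> tail G (q k) \<noteq> tail G (q i)" by auto
    then have "{k. tail G (q k) = tail G (q i)} \<subseteq> {..<N}"
      using not_less by auto
    then show ?thesis by (rule finite_subset) simp
  qed
  have last_vertex: "tail G (q (last i)) = tail G (q i)" for i
    using Max_in[OF fin[of i]] unfolding last_def by blast
  have last_max: "k \<le> last i" if "tail G (q k) = tail G (q i)" for k i
    using Max_ge[OF fin[of i], of k] that unfolding last_def by blast
  \<comment> \<open>\<open>t j\<close> is the time at which \<open>q\<close> visits the \<open>j\<close>-th vertex of the ray for the last time.\<close>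
  define t where "t = rec_nat (last 0) (\<lambda>_ k. last (Suc k))"
  have t_Suc: "t (Suc j) = last (Suc (t j))" for j
    by (simp add: t_def)
  have t_last: "t j = last (t j)" for j
  proof -
    obtain i where "t j = last i" by (cases j) (auto simp: t_def)
    then show ?thesis using last_vertex[of i] by (simp add: last_def)
  qed
  have "t j < t (Suc j)" for j
    using last_max[of "Suc (t j)" "Suc (t j)"] by (simp add: t_Suc)
  then have t_mono: "strict_mono t" by (simp add: strict_mono_Suc_iff)
  define p where "p j = q (t j)" for j
  have "p \<in> inf_paths G"
    using inf_paths_arc[OF qp] inf_paths_head[OF qp] last_vertex
    by (simp add: inf_paths_def p_def t_Suc)
  moreover have "inj (\<lambda>j. tail G (p j))"
  proof (rule injI)
    fix i j assume "tail G (p i) = tail G (p j)"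
    then have "t i = t j"
      using t_last unfolding p_def last_def by metis
    then show "i = j" using t_mono by (simp add: strict_mono_eq)
  qed
  ultimately have "p \<in> rays G" by (simp add: rays_def)
  moreover have "(\<lambda>k. f (tail G (p k))) \<longlonglongrightarrow> L" if "(\<lambda>k. f (tail G (q k))) \<longlonglongrightarrow> L"
    for f :: "'v \<Rightarrow> 'b" and L
    using LIMSEQ_subseq_LIMSEQ[OF that t_mono] by (simp add: p_def comp_def)
  ultimately show thesis by (rule that)
qed

end

section \<open>Powers of the transition matrix and the Green kernel\<close>

locale potential_digraph = countable_digraph G for G :: "('v, 'a) pre_digraph" +
  fixes F :: "'a \<Rightarrow> real" and \<beta> :: real
begin

abbreviation wt :: "'a \<Rightarrow> ennreal" where
  "wt a \<equiv> ennreal (exp (- \<beta> * F a))"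

abbreviation P :: "nat \<Rightarrow> 'v \<Rightarrow> 'v \<Rightarrow> ennreal" where
  "P \<equiv> arrow_matrix_pow G F \<beta>"

text \<open>
  Arrows out of \<open>v\<close> are grouped by their range. With \<open>g u\<close> the mass of a set of paths starting at
  \<open>u\<close>, this turns the decomposition by the first arrow into a matrix product.
\<close>

lemma nn_integral_out_arcs:
  "(\<integral>\<^sup>+a. wt a * g (head G a) \<partial>count_space {a \<in> arcs G. tail G a = v}) =
   (\<integral>\<^sup>+u. arrow_matrix G F \<beta> v u * g u \<partial>count_space (verts G))"
proof -
  let ?S = "{a \<in> arcs G. tail G a = v}"
  have "(\<integral>\<^sup>+u. arrow_matrix G F \<beta> v u * g u \<partial>count_space (verts G)) =
      (\<integral>\<^sup>+u. \<integral>\<^sup>+a. (if head G a = u then wt a * g u else 0) \<partial>count_space ?S \<partial>count_space (verts G))"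
  proof (rule nn_integral_cong)
    fix u
    have "arrow_matrix G F \<beta> v u * g u =
        (\<integral>\<^sup>+a. wt a * g u \<partial>count_space {a \<in> arcs G. tail G a = v \<and> head G a = u})"
      by (simp add: arrow_matrix_def nn_integral_multc)
    also have "\<dots> = (\<integral>\<^sup>+a. (if head G a = u then wt a * g u else 0)
        \<partial>count_space {a \<in> arcs G. tail G a = v \<and> head G a = u})"
      by (rule nn_integral_cong) auto
    also have "\<dots> = (\<integral>\<^sup>+a. (if head G a = u then wt a * g u else 0) \<partial>count_space ?S)"
      by (rule nn_integral_count_space_eq) auto
    finally show "arrow_matrix G F \<beta> v u * g u =
        (\<integral>\<^sup>+a. (if head G a = u then wt a * g u else 0) \<partial>count_space ?S)" .
  qed
  also have "\<dots> = (\<integral>\<^sup>+a. \<integral>\<^sup>+u. (if head G a = u then wt a * g u else 0)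
      \<partial>count_space (verts G) \<partial>count_space ?S)"
    by (rule nn_integral_count_space_nn_integral[symmetric]) (auto simp: countable_verts)
  also have "\<dots> = (\<integral>\<^sup>+a. wt a * g (head G a) \<partial>count_space ?S)"
  proof (rule nn_integral_cong)
    fix a assume "a \<in> space (count_space ?S)"
    then have "head G a \<in> verts G" by auto
    then show "(\<integral>\<^sup>+u. (if head G a = u then wt a * g u else 0) \<partial>count_space (verts G)) =
        wt a * g (head G a)"
      by (subst nn_integral_count_space'[of "{head G a}"]) auto
  qed
  finally show ?thesis by simp
qed

lemma arrow_matrix_pow_mult_le: "P k u v * P n v w \<le> P (k + n) u w"
proof (induction k arbitrary: u)
  case (Suc k)
  have "P (Suc k) u v * P n v w =
      (\<integral>\<^sup>+x. arrow_matrix G F \<beta> u x * P k x v * P n v w \<partial>count_space (verts G))"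
    by (simp add: nn_integral_multc)
  also have "\<dots> \<le> P (Suc k + n) u w"
    by (auto intro!: nn_integral_mono mult_left_mono Suc simp: mult.assoc)
  finally show ?case .
qed auto

lemma green_mult_le: "P k u v * green G F \<beta> v w \<le> green G F \<beta> u w"
proof -
  have "P k u v * green G F \<beta> v w = (\<Sum>n. P k u v * P n v w)"
    by (simp add: green_def)
  also have "\<dots> \<le> (\<Sum>n. P (n + k) u w)"
    by (intro suminf_le) (auto simp: arrow_matrix_pow_mult_le add.commute[of _ k])
  also have "\<dots> \<le> (\<Sum>n. P n u w)"
    using suminf_offset[OF summableI, of "\<lambda>n. P n u w" k] by (simp add: le_iff_add add.commute)
  finally show ?thesis by (simp add: green_def)
qed

end

section \<open>Conformal measures\<close>

locale conformal_measure = potential_digraph G F \<beta>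
  for G :: "('v, 'a) pre_digraph" and F :: "'a \<Rightarrow> real" and \<beta> :: real +
  fixes m :: "(nat \<Rightarrow> 'a) measure"
  assumes conformal: "conformal G F \<beta> m"
begin

lemma sets_m [measurable_cong]: "sets m = sets (path_borel G)"
  using conformal by (simp add: conformal_def)

lemma space_m [simp]: "space m = inf_paths G"
  using sets_eq_imp_space_eq[OF sets_m] by simp

lemma emeasure_inf_paths: "emeasure m (inf_paths G) \<noteq> 0"
  using conformal by (simp add: conformal_def)

lemma emeasure_vertex_cyl_finite: "v \<in> verts G \<Longrightarrow> emeasure m (vertex_cyl G v) < \<infinity>"
  using conformal by (simp add: conformal_def)

text \<open>
  The conformality condition read backwards: putting the arrow \<open>a\<close> in front of the paths in \<open>C\<close>
  scales the measure by \<open>wt a\<close>. Here \<open>C\<close> is the shift image of \<open>{q \<in> arrow_cyl G a. path_shift q \<in> C}\<close>.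
\<close>

lemma emeasure_arrow_pullback:
  assumes a: "a \<in> arcs G" and C: "C \<in> sets m" "C \<subseteq> vertex_cyl G (head G a)"
  shows "emeasure m {q \<in> arrow_cyl G a. path_shift q \<in> C} = wt a * emeasure m C"
proof -
  let ?B = "path_shift -` C \<inter> space m"
  have B: "?B \<in> sets m"
    using C(1) by measurable
  have *: "path_shift ` (?B \<inter> arrow_cyl G a) = C"
  proof (intro equalityI subsetI)
    fix q assume q: "q \<in> C"
    then have "case_nat a q \<in> ?B \<inter> arrow_cyl G a"
      using C(2) inf_paths_Cons[OF a, of q] by (auto simp: vertex_cyl_def arrow_cyl_def path_shift_def)
    then show "q \<in> path_shift ` (?B \<inter> arrow_cyl G a)"
      by (rule rev_image_eqI) (simp add: path_shift_def)
  qed auto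
  have "emeasure m (path_shift ` (?B \<inter> arrow_cyl G a)) =
      ennreal (exp (\<beta> * F a)) * emeasure m (?B \<inter> arrow_cyl G a)"
    using conformal a B unfolding conformal_def by auto
  then have "wt a * emeasure m C = wt a * ennreal (exp (\<beta> * F a)) * emeasure m (?B \<inter> arrow_cyl G a)"
    unfolding * by (simp add: mult.assoc)
  also have "wt a * ennreal (exp (\<beta> * F a)) = 1"
    by (simp add: ennreal_mult[symmetric] exp_add[symmetric])
  also have "?B \<inter> arrow_cyl G a = {q \<in> arrow_cyl G a. path_shift q \<in> C}"
    by (auto simp: arrow_cyl_def)
  finally show ?thesis by simp
qed

text \<open>
  The Markov property of a conformal measure, by induction on \<open>n\<close>, decomposing by the first arrow.
\<close>

lemma emeasure_funpow_pullback:
  assumes T: "T \<in> sets m" "T \<subseteq> vertex_cyl G w"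
  shows "emeasure m {q \<in> vertex_cyl G v. (path_shift ^^ n) q \<in> T} = P n v w * emeasure m T"
proof (induction n arbitrary: v)
  case 0
  show ?case
  proof (cases "v = w")
    case True
    then have "{q \<in> vertex_cyl G v. (path_shift ^^ 0) q \<in> T} = T"
      using T(2) by auto
    then show ?thesis using True by simp
  next
    case False
    then have "{q \<in> vertex_cyl G v. (path_shift ^^ 0) q \<in> T} = {}"
      using T(2) by (auto simp: vertex_cyl_def)
    then show ?thesis using False by (simp only: emeasure_empty) simp
  qed
next
  case (Suc n)
  define C where "C u = {q \<in> vertex_cyl G u. (path_shift ^^ n) q \<in> T}" for u
  have C [measurable]: "C u \<in> sets m" for u
  proof -
    have "C u = vertex_cyl G u \<inter> ((path_shift ^^ n) -` T \<inter> space m)"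
      by (auto simp: C_def vertex_cyl_def)
    moreover have "(path_shift ^^ n) -` T \<inter> space m \<in> sets m"
    proof -
      have "path_shift ^^ n \<in> measurable m m" for n
        by (induction n) (auto intro: measurable_comp[of _ m m _ m])
      then show ?thesis using T(1) by (rule measurable_sets)
    qed
    ultimately show ?thesis by auto
  qed
  let ?S = "{a \<in> arcs G. tail G a = v}"
  have "emeasure m {q \<in> vertex_cyl G v. (path_shift ^^ Suc n) q \<in> T} =
      emeasure m (\<Union>a\<in>?S. {q \<in> arrow_cyl G a. path_shift q \<in> C (head G a)})"
  proof (rule arg_cong[of _ _ "emeasure m"], intro equalityI subsetI)
    fix q assume "q \<in> {q \<in> vertex_cyl G v. (path_shift ^^ Suc n) q \<in> T}"
    then show "q \<in> (\<Union>a\<in>?S. {q \<in> arrow_cyl G a. path_shift q \<in> C (head G a)})"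
      using inf_paths_arc[of q 0] inf_paths_head[of q 0] path_shift_inf_paths[of q]
      by (intro UN_I[of "q 0"])
        (auto simp: vertex_cyl_def arrow_cyl_def C_def funpow_Suc_right path_shift_def[of q]
          simp del: funpow.simps)
  qed (auto simp: vertex_cyl_def arrow_cyl_def C_def funpow_Suc_right simp del: funpow.simps)
  also have "\<dots> = (\<integral>\<^sup>+a. emeasure m {q \<in> arrow_cyl G a. path_shift q \<in> C (head G a)} \<partial>count_space ?S)"
  proof (rule emeasure_UN_countable)
    fix a
    have "{q \<in> arrow_cyl G a. path_shift q \<in> C (head G a)} =
        word_cyl G [a] \<inter> (path_shift -` C (head G a) \<inter> space m)"
      by (auto simp: arrow_cyl_eq_word_cyl word_cyl_def)
    also have "\<dots> \<in> sets m" by measurable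
    finally show "{q \<in> arrow_cyl G a. path_shift q \<in> C (head G a)} \<in> sets m" .
  next
    show "countable ?S"
      using countable_arcs by (rule countable_subset[rotated]) auto
  qed (auto simp: disjoint_family_on_def arrow_cyl_def)
  also have "\<dots> = (\<integral>\<^sup>+a. wt a * (P n (head G a) w * emeasure m T) \<partial>count_space ?S)"
  proof (rule nn_integral_cong)
    fix a assume "a \<in> space (count_space ?S)"
    then have "emeasure m {q \<in> arrow_cyl G a. path_shift q \<in> C (head G a)} =
        wt a * emeasure m (C (head G a))"
      by (intro emeasure_arrow_pullback C) (auto simp: C_def)
    then show "emeasure m {q \<in> arrow_cyl G a. path_shift q \<in> C (head G a)} =
        wt a * (P n (head G a) w * emeasure m T)"
      using Suc unfolding C_def by simp
  qed
  also have "\<dots> = (\<integral>\<^sup>+u. arrow_matrix G F \<beta> v u * (P n u w * emeasure m T) \<partial>count_space (verts G))"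
    by (rule nn_integral_out_arcs)
  also have "\<dots> = P (Suc n) v w * emeasure m T"
    by (simp add: nn_integral_multc mult.assoc[symmetric])
  finally show ?case .
qed

text \<open>
  Stripping the first arrow of a word scales both measures by the same factor, until only the
  set of paths starting at the final vertex of the word is left.
\<close>

lemma emeasure_word_cyl_proportional:
  assumes "conformal_measure G F \<beta> m'"
    and eq: "\<And>v. v \<in> verts G \<Longrightarrow> emeasure m' (vertex_cyl G v) = c * emeasure m (vertex_cyl G v)"
  shows "emeasure m' (word_cyl G (a # l)) = c * emeasure m (word_cyl G (a # l))"
proof (induction l arbitrary: a)
  interpret m': conformal_measure G F \<beta> m' by fact
  have step: "emeasure m' (word_cyl G (a # l)) = c * emeasure m (word_cyl G (a # l))"
    if a: "a \<in> arcs G" and C: "C \<in> sets (path_borel G)" "C \<subseteq> vertex_cyl G (head G a)"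
      and l: "word_cyl G (a # l) = {q \<in> arrow_cyl G a. path_shift q \<in> C}"
      and "emeasure m' C = c * emeasure m C" for a l C
    using that emeasure_arrow_pullback[of a C] m'.emeasure_arrow_pullback[of a C]
    by (simp add: sets_m m'.sets_m mult.left_commute)
  {
    case Nil
    show ?case
    proof (cases "a \<in> arcs G")
      case True
      show ?thesis
        by (rule step[OF True vertex_cyl_sets order_refl])
          (use True path_shift_inf_paths inf_paths_head[of _ 0] eq in
            \<open>auto simp: word_cyl_def arrow_cyl_def vertex_cyl_def path_shift_apply\<close>)
    next
      case False
      then have "word_cyl G [a] = {}"
        using inf_paths_arc[of _ 0] by (auto simp: word_cyl_def)
      then show ?thesis by simp
    qed
  next
    case (Cons b l)
    show ?case
    proof (cases "a \<in> arcs G \<and> head G a = tail G b")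
      case True
      show ?thesis
      proof (rule step[OF _ word_cyl_sets])
        show "word_cyl G (a # b # l) = {q \<in> arrow_cyl G a. path_shift q \<in> word_cyl G (b # l)}"
          by (auto simp: word_cyl_Cons[of a] arrow_cyl_def)
        show "word_cyl G (b # l) \<subseteq> vertex_cyl G (head G a)"
          using True by (auto simp: word_cyl_def vertex_cyl_def)
      qed (use True Cons in auto)
    next
      case False
      then have "word_cyl G (a # b # l) = {}"
        using inf_paths_arc[of _ 0] inf_paths_head[of _ 0] by (fastforce simp: word_cyl_def)
      then show ?thesis by simp
    qed
  }
qed

text \<open>
  The cylinders over nonempty words generate the Borel sets and are stable under intersection up to
  the empty set; those over single arrows cover the path space and have finite measure.
\<close>

lemma conformal_eq_scaleI:
  assumes m': "conformal_measure G F \<beta> m'"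
    and eq: "\<And>v. v \<in> verts G \<Longrightarrow> emeasure m' (vertex_cyl G v) = c * emeasure m (vertex_cyl G v)"
  shows "m' = scale_measure c m"
proof (rule measure_eqI_generator_eq_countable)
  interpret m': conformal_measure G F \<beta> m' by fact
  let ?E = "insert {} (word_cyl G ` {l. l \<noteq> []})"
  show "?E \<subseteq> Pow (inf_paths G)"
    by (auto simp: word_cyl_def)
  show "sets m' = sigma_sets (inf_paths G) ?E" "sets (scale_measure c m) = sigma_sets (inf_paths G) ?E"
    by (simp_all add: sets_m m'.sets_m sets_path_borel)
  show "emeasure m' X = emeasure (scale_measure c m) X" if "X \<in> ?E" for X
    using that emeasure_word_cyl_proportional[OF m' eq] by (auto simp: neq_Nil_conv)
  \<comment> \<open>Two cylinders are nested or disjoint, according to whether the shorter word is a prefix.\<close>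
  have nested: "word_cyl G k \<inter> word_cyl G l \<in> {{}, word_cyl G l}" if "length k \<le> length l" for k l
  proof (cases "\<forall>i<length k. k ! i = l ! i")
    case True
    then have "word_cyl G k \<inter> word_cyl G l = word_cyl G l"
      using that by (auto simp: word_cyl_def)
    then show ?thesis by simp
  next
    case False
    then have "word_cyl G k \<inter> word_cyl G l = {}"
      using that by (auto simp: word_cyl_def)
    then show ?thesis by simp
  qed
  have "word_cyl G k \<inter> word_cyl G l \<in> ?E" if "k \<noteq> []" "l \<noteq> []" for k l
    using nested[of k l] nested[of l k] that by (cases "length k \<le> length l") (auto simp: Int_commute)
  then show "Int_stable ?E"
    by (auto simp: Int_stable_def)
  let ?A = "(\<lambda>a. word_cyl G [a]) ` arcs G"
  show "?A \<subseteq> ?E" by auto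
  show "\<Union> ?A = inf_paths G"
    using inf_paths_arc[of _ 0] by (auto simp: word_cyl_def)
  show "countable ?A" using countable_arcs by simp
  show "emeasure m' X \<noteq> \<infinity>" if "X \<in> ?A" for X
  proof -
    obtain a where a: "a \<in> arcs G" "X = word_cyl G [a]" using \<open>X \<in> ?A\<close> by auto
    then have "X \<subseteq> vertex_cyl G (tail G a)"
      by (auto simp: word_cyl_def vertex_cyl_def)
    then have "emeasure m' X \<le> emeasure m' (vertex_cyl G (tail G a))"
      by (rule emeasure_mono) (simp add: m'.sets_m vertex_cyl_sets)
    then show ?thesis
      using m'.emeasure_vertex_cyl_finite[of "tail G a"] a by auto
  qed
qed

lemma emeasure_eq_0_if_vertex_cyl:
  assumes "A \<in> sets m" "\<And>v. v \<in> verts G \<Longrightarrow> emeasure m (A \<inter> vertex_cyl G v) = 0"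
  shows "emeasure m A = 0"
proof -
  have "A = (\<Union>v\<in>verts G. A \<inter> vertex_cyl G v)"
    using sets.sets_into_space[OF assms(1)] inf_paths_eq_UN_vertex_cyl by auto
  moreover have "(\<Union>v\<in>verts G. A \<inter> vertex_cyl G v) \<in> null_sets m"
    using assms by (intro null_sets_UN' countable_verts) (auto simp: null_sets_def sets_m)
  ultimately show ?thesis by (metis null_setsD1)
qed

text \<open>
  Invariance of \<open>D\<close> lets the intersection with \<open>D\<close> pass through the shift image.
\<close>

lemma conformal_restrict:
  assumes D: "D \<in> sets m" "path_shift -` D \<inter> inf_paths G = D" and pos: "emeasure m D \<noteq> 0"
  shows "conformal G F \<beta> (density m (indicator D))"
proof -
  let ?D = "density m (indicator D)"
  have [simp]: "emeasure ?D X = emeasure m (X \<inter> D)" if "X \<in> sets (path_borel G)" for X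
    using emeasure_restricted[OF D(1), of X] that by (simp add: sets_m Int_commute)
  have Df: "D \<subseteq> inf_paths G"
    using sets.sets_into_space[OF D(1)] by simp
  show ?thesis
    unfolding conformal_def
  proof (intro conjI ballI)
    show "sets ?D = sets (path_borel G)" by (simp add: sets_m)
    have "inf_paths G \<in> sets (path_borel G)"
      using sets.top[of "path_borel G"] by simp
    then show "emeasure ?D (inf_paths G) \<noteq> 0"
      using pos Df by (simp add: Int_absorb1)
    fix v assume "v \<in> verts G"
    have "emeasure m (vertex_cyl G v \<inter> D) \<le> emeasure m (vertex_cyl G v)"
      by (intro emeasure_mono) (auto simp: sets_m)
    then show "emeasure ?D (vertex_cyl G v) < \<infinity>"
      using emeasure_vertex_cyl_finite[OF \<open>v \<in> verts G\<close>] by (simp add: vertex_cyl_sets)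
  next
    fix a B assume a: "a \<in> arcs G" and B: "B \<in> sets (path_borel G)"
    have "path_shift ` (B \<inter> arrow_cyl G a) \<inter> D = path_shift ` ((B \<inter> D) \<inter> arrow_cyl G a)"
    proof -
      have "path_shift q \<in> D \<longleftrightarrow> q \<in> D" if "q \<in> inf_paths G" for q
        using D(2) that by blast
      then show ?thesis by (auto simp: arrow_cyl_def)
    qed
    moreover have "B \<inter> D \<in> sets (path_borel G)"
      using B D(1) by (auto simp: sets_m)
    ultimately have "emeasure m (path_shift ` (B \<inter> arrow_cyl G a) \<inter> D) =
        ennreal (exp (\<beta> * F a)) * emeasure m ((B \<inter> D) \<inter> arrow_cyl G a)"
      using conformal a unfolding conformal_def by auto
    moreover have "B \<inter> arrow_cyl G a \<in> sets (path_borel G)"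
      using B unfolding arrow_cyl_eq_word_cyl by measurable
    ultimately show "emeasure ?D (path_shift ` (B \<inter> arrow_cyl G a)) =
        ennreal (exp (\<beta> * F a)) * emeasure ?D (B \<inter> arrow_cyl G a)"
      using path_shift_image_sets[OF B, of a] by (simp add: Int_ac)
  qed
qed

text \<open>
  The restriction of an extremal \<open>m\<close> to a non-null invariant set \<open>D\<close> is a multiple of \<open>m\<close> that
  vanishes outside \<open>D\<close>; as the factor is positive, so does \<open>m\<close>.
\<close>

lemma ergodic_if_extremal:
  assumes "extremal_conformal G F \<beta> m"
  shows "shift_ergodic G m"
  unfolding shift_ergodic_def
proof (intro ballI impI)
  fix D assume D: "D \<in> sets (path_borel G)" "path_shift -` D \<inter> inf_paths G = D"
  show "emeasure m D = 0 \<or> emeasure m (inf_paths G - D) = 0"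
  proof (cases "emeasure m D = 0")
    case False
    let ?D = "density m (indicator D)"
    have Dm: "D \<in> sets m" using D(1) by (simp add: sets_m)
    have em: "emeasure ?D X = emeasure m (D \<inter> X)" if "X \<in> sets (path_borel G)" for X
      using emeasure_restricted[OF Dm, of X] that by (simp add: sets_m)
    have "emeasure m (D \<inter> B) \<le> emeasure m B" if "B \<in> sets (path_borel G)" for B
      using that by (intro emeasure_mono) (auto simp: sets_m)
    then obtain c where c: "c > 0" "?D = scale_measure (ennreal c) m"
      using assms conformal_restrict[OF Dm D(2) False] em unfolding extremal_conformal_def by metis
    have X: "inf_paths G - D \<in> sets (path_borel G)"
      using sets.compl_sets[OF D(1)] by simp
    have "ennreal c * emeasure m (inf_paths G - D) = emeasure ?D (inf_paths G - D)"
      using c(2) by simp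
    also have "\<dots> = 0" using em[OF X] by simp
    finally show ?thesis using c(1) by simp
  qed simp
qed

end

section \<open>Transience and the last-exit decomposition\<close>

locale transient_conformal_measure = conformal_measure G F \<beta> m
  for G :: "('v, 'a) pre_digraph" and F :: "'a \<Rightarrow> real" and \<beta> :: real
    and m :: "(nat \<Rightarrow> 'a) measure" +
  fixes v0 :: 'v
  assumes v0: "v0 \<in> verts G"
    and green_pos: "v \<in> verts G \<Longrightarrow> 0 < green G F \<beta> v0 v"
    and green_finite: "v \<in> verts G \<Longrightarrow> green G F \<beta> v0 v < \<infinity>"
begin

lemma arrow_matrix_pow_pos:
  assumes "v \<in> verts G"
  obtains k where "0 < P k v0 v"
proof -
  have "\<exists>k. P k v0 v \<noteq> 0"
  proof (rule ccontr)
    assume "\<nexists>k. P k v0 v \<noteq> 0"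
    then have "green G F \<beta> v0 v = 0" by (simp add: green_def)
    then show False using green_pos[OF assms] by simp
  qed
  then show thesis using that by (auto simp: zero_less_iff_neq_zero)
qed

text \<open>
  Every vertex \<open>v\<close> is reached from \<open>v0\<close> with positive weight, so an infinite Green kernel at \<open>v\<close>
  would make the one at \<open>v0\<close> infinite.
\<close>

lemma green_finite_all:
  assumes v: "v \<in> verts G" and w: "w \<in> verts G"
  shows "green G F \<beta> v w < \<infinity>"
proof -
  obtain k where k: "0 < P k v0 v" using arrow_matrix_pow_pos[OF v] .
  have "P k v0 v * green G F \<beta> v w < \<infinity>"
    using green_mult_le[of k v0 v w] green_finite[OF w] by (rule le_less_trans)
  then show ?thesis
    using k by (auto simp: ennreal_mult_less_top less_top)
qed

lemma emeasure_visit_le: "P k v w * emeasure m (vertex_cyl G w) \<le> emeasure m (vertex_cyl G v)"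
proof -
  have "emeasure m {q \<in> vertex_cyl G v. (path_shift ^^ k) q \<in> vertex_cyl G w} =
      P k v w * emeasure m (vertex_cyl G w)"
    by (rule emeasure_funpow_pullback) (auto simp: sets_m vertex_cyl_sets)
  moreover have "emeasure m {q \<in> vertex_cyl G v. (path_shift ^^ k) q \<in> vertex_cyl G w} \<le>
      emeasure m (vertex_cyl G v)"
    by (rule emeasure_mono) (auto simp: sets_m vertex_cyl_sets)
  ultimately show ?thesis by simp
qed

lemma emeasure_v0_pos: "0 < emeasure m (vertex_cyl G v0)"
proof (rule ccontr)
  assume "\<not> ?thesis"
  then have 0: "emeasure m (vertex_cyl G v0) = 0" by simp
  have "emeasure m (vertex_cyl G v) = 0" if "v \<in> verts G" for v
  proof -
    obtain k where "0 < P k v0 v" using arrow_matrix_pow_pos[OF \<open>v \<in> verts G\<close>] .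
    then show ?thesis using emeasure_visit_le[of k v0 v] 0 by auto
  qed
  moreover have "inf_paths G \<inter> vertex_cyl G v = vertex_cyl G v" for v
    by (auto simp: vertex_cyl_def)
  moreover have "inf_paths G \<in> sets m"
    using sets.top[of m] unfolding space_m .
  ultimately have "emeasure m (inf_paths G) = 0"
    using emeasure_eq_0_if_vertex_cyl[of "inf_paths G"] by metis
  then show False using emeasure_inf_paths by contradiction
qed

text \<open>
  The events of being at \<open>w\<close> at time \<open>n\<close> have total mass \<open>green v w * m\<^sub>w < \<infinity>\<close>, so the
  Borel--Cantelli lemma applies.
\<close>

lemma AE_leaves_vertex:
  assumes v: "v \<in> verts G" and w: "w \<in> verts G"
  shows "AE q in m. q \<in> vertex_cyl G v \<longrightarrow> (\<forall>\<^sub>F n in sequentially. tail G (q n) \<noteq> w)"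
proof -
  let ?A = "\<lambda>n. {q \<in> vertex_cyl G v. (path_shift ^^ n) q \<in> vertex_cyl G w}"
  have A: "?A n = {q \<in> vertex_cyl G v. tail G (q n) \<in> {w}}" for n
    using path_shift_funpow_inf_paths by (auto simp: vertex_cyl_def path_shift_funpow)
  have A_eq: "?A n = vertex_cyl G v \<inter> {q \<in> space m. tail G (q n) \<in> {w}}" for n
    unfolding A by (auto simp: vertex_cyl_def)
  have A_sets: "?A n \<in> sets m" for n
    unfolding A_eq by measurable
  have em: "emeasure m (?A n) = P n v w * emeasure m (vertex_cyl G w)" for n
    by (rule emeasure_funpow_pullback) (auto simp: sets_m vertex_cyl_sets)
  have sum: "(\<Sum>n. emeasure m (?A n)) < \<infinity>"
    unfolding em using green_finite_all[OF v w] emeasure_vertex_cyl_finite[OF w]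
    by (simp add: green_def[symmetric] ennreal_mult_less_top)
  have fin: "emeasure m (?A n) < \<infinity>" for n
    by (rule le_less_trans[OF emeasure_mono emeasure_vertex_cyl_finite[OF v]])
      (auto simp: sets_m vertex_cyl_sets)
  have "summable (\<lambda>n. measure m (?A n))"
  proof (rule summable_suminf_not_top)
    show "(\<Sum>n. ennreal (measure m (?A n))) \<noteq> top"
    proof -
      have "ennreal (measure m (?A n)) = emeasure m (?A n)" for n
        using fin[of n] by (intro emeasure_eq_ennreal_measure[symmetric]) simp
      then show ?thesis using sum by simp
    qed
  qed simp
  then have "AE q in m. \<forall>\<^sub>F n in sequentially. q \<in> space m - ?A n"
    by (intro borel_cantelli_AE1 A_sets fin)
  then show ?thesis
  proof (eventually_elim, intro impI)
    fix q assume ev: "\<forall>\<^sub>F n in sequentially. q \<in> space m - ?A n" and q: "q \<in> vertex_cyl G v"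
    show "\<forall>\<^sub>F n in sequentially. tail G (q n) \<noteq> w"
      using ev by (rule eventually_mono) (use q in \<open>auto simp: A\<close>)
  qed
qed

lemma AE_leaves_every_vertex:
  "AE q in m. \<forall>w\<in>verts G. \<forall>\<^sub>F n in sequentially. tail G (q n) \<noteq> w"
proof -
  have "AE q in m. \<forall>v\<in>verts G. \<forall>w\<in>verts G.
      q \<in> vertex_cyl G v \<longrightarrow> (\<forall>\<^sub>F n in sequentially. tail G (q n) \<noteq> w)"
    unfolding AE_ball_countable[OF countable_verts] using AE_leaves_vertex by blast
  then show ?thesis
    using AE_space by eventually_elim (auto simp: vertex_cyl_def inf_paths_tail)
qed

lemma AE_wandering: "AE q in m. q \<in> wandering G"
  using AE_leaves_every_vertex AE_space by eventually_elim (simp add: wandering_iff)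

definition hitting :: "'v set \<Rightarrow> (nat \<Rightarrow> 'a) set" where
  "hitting W = {q \<in> inf_paths G. \<exists>n. tail G (q n) \<in> W}"

lemma hitting_sets [measurable]: "hitting W \<in> sets m"
proof -
  have "{q \<in> space m. \<exists>n. tail G (q n) \<in> W} \<in> sets m"
    by measurable
  then show ?thesis by (simp add: hitting_def)
qed

text \<open>
  The last-exit decomposition. Almost every path meeting the finite set \<open>H\<close> has a unique pair of a
  time \<open>n\<close> and a vertex \<open>w\<close> of its last visit; after time \<open>n\<close> it is a path from \<open>w\<close> that never
  returns to \<open>H\<close>. Only the factor \<open>green u w\<close> depends on the starting vertex.
\<close>

lemma emeasure_hitting_finite_set:
  assumes H: "finite H" "H \<subseteq> verts G"
  shows "emeasure m (vertex_cyl G u \<inter> hitting H) =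
    (\<Sum>w\<in>H. green G F \<beta> u w * emeasure m {q \<in> vertex_cyl G w. \<forall>k>0. tail G (q k) \<notin> H})"
proof -
  define T where "T w = {q \<in> vertex_cyl G w. \<forall>k>0. tail G (q k) \<notin> H}" for w
  define S where "S n w = {q \<in> vertex_cyl G u. (path_shift ^^ n) q \<in> T w}" for n w
  have S: "S n w = {q \<in> vertex_cyl G u. tail G (q n) = w \<and> (\<forall>k>n. tail G (q k) \<notin> H)}" for n w
  proof -
    have "(\<forall>k>0. tail G (q (n + k)) \<notin> H) \<longleftrightarrow> (\<forall>k>n. tail G (q k) \<notin> H)" for q
      by (metis add_diff_inverse_nat less_add_same_cancel1 not_less_iff_gr_or_eq zero_less_diff)
    then show ?thesis
      using path_shift_funpow_inf_paths
      by (auto simp: S_def T_def vertex_cyl_def path_shift_funpow)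
  qed
  have T_sets: "T w \<in> sets m" for w
  proof -
    have "T w = vertex_cyl G w \<inter> {q \<in> space m. \<forall>k>0. \<not> tail G (q k) \<in> H}"
      by (auto simp: T_def vertex_cyl_def)
    also have "\<dots> \<in> sets m" by measurable
    finally show ?thesis .
  qed
  have S_sets: "S n w \<in> sets m" for n w
  proof -
    have "S n w = vertex_cyl G u \<inter> {q \<in> space m. tail G (q n) \<in> {w} \<and> (\<forall>k>n. \<not> tail G (q k) \<in> H)}"
      unfolding S by (auto simp: vertex_cyl_def)
    also have "\<dots> \<in> sets m" by measurable
    finally show ?thesis .
  qed
  have em: "emeasure m (S n w) = P n u w * emeasure m (T w)" for n w
    unfolding S_def by (rule emeasure_funpow_pullback[OF T_sets]) (auto simp: T_def)
  have disj_w: "disjoint_family_on (S n) H" for n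
    by (auto simp: disjoint_family_on_def S)
  have disj_n: "disjoint_family (\<lambda>n. \<Union>w\<in>H. S n w)"
    unfolding disjoint_family_on_def
  proof (intro ballI impI)
    fix i j :: nat assume "i \<noteq> j"
    then show "(\<Union>w\<in>H. S i w) \<inter> (\<Union>w\<in>H. S j w) = {}"
      by (cases i j rule: linorder_cases) (auto simp: S)
  qed
  have "emeasure m (vertex_cyl G u \<inter> hitting H) = emeasure m (\<Union>n. \<Union>w\<in>H. S n w)"
  proof (rule emeasure_eq_AE)
    show "AE q in m. q \<in> vertex_cyl G u \<inter> hitting H \<longleftrightarrow> q \<in> (\<Union>n. \<Union>w\<in>H. S n w)"
      using AE_leaves_every_vertex
    proof eventually_elim
      fix q assume leaves: "\<forall>w\<in>verts G. \<forall>\<^sub>F n in sequentially. tail G (q n) \<noteq> w"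
      have "\<exists>n. tail G (q n) \<in> H \<and> (\<forall>k>n. tail G (q k) \<notin> H)" if "\<exists>n. tail G (q n) \<in> H"
      proof -
        have "\<forall>\<^sub>F n in sequentially. \<forall>w\<in>H. tail G (q n) \<noteq> w"
          using H leaves by (intro eventually_ball_finite) auto
        then obtain N where N: "\<And>n. n \<ge> N \<Longrightarrow> tail G (q n) \<notin> H"
          by (auto simp: eventually_sequentially)
        let ?V = "{n. tail G (q n) \<in> H}"
        have "?V \<subseteq> {..N}"
          using N by (auto intro: ccontr simp: not_le less_imp_le)
        then have fin: "finite ?V" by (rule finite_subset) simp
        have "?V \<noteq> {}" using that by auto
        with fin have "Max ?V \<in> ?V" by (rule Max_in)
        moreover have "k \<notin> ?V" if "k > Max ?V" for k
          using that Max_ge[OF fin, of k] by linarith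
        ultimately show ?thesis by blast
      qed
      then show "q \<in> vertex_cyl G u \<inter> hitting H \<longleftrightarrow> q \<in> (\<Union>n. \<Union>w\<in>H. S n w)"
        by (auto simp: S hitting_def vertex_cyl_def)
    qed
    show "vertex_cyl G u \<inter> hitting H \<in> sets m" by measurable
    show "(\<Union>n. \<Union>w\<in>H. S n w) \<in> sets m"
      using H(1) S_sets by (auto intro!: sets.countable_UN sets.finite_UN)
  qed
  also have "\<dots> = (\<Sum>n. emeasure m (\<Union>w\<in>H. S n w))"
    using H(1) S_sets disj_n by (intro suminf_emeasure[symmetric]) (auto intro!: sets.finite_UN)
  also have "\<dots> = (\<Sum>n. \<Sum>w\<in>H. emeasure m (S n w))"
    using H(1) S_sets disj_w by (subst sum_emeasure) auto
  also have "\<dots> = (\<Sum>w\<in>H. \<Sum>n. P n u w * emeasure m (T w))"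
    unfolding em by (rule suminf_sum) simp
  also have "\<dots> = (\<Sum>w\<in>H. green G F \<beta> u w * emeasure m (T w))"
    by (simp add: green_def)
  finally show ?thesis unfolding T_def .
qed

text \<open>
  For finite \<open>W\<close> the last-exit decompositions of both sides are compared term by term. For infinite
  \<open>W\<close> there need not be a last visit, and \<open>W\<close> is exhausted by finite sets.
\<close>

lemma emeasure_hitting_mono:
  assumes W: "W \<subseteq> verts G"
    and le: "\<And>w. w \<in> W \<Longrightarrow> x * green G F \<beta> u w \<le> y * green G F \<beta> u' w"
  shows "x * emeasure m (vertex_cyl G u \<inter> hitting W) \<le> y * emeasure m (vertex_cyl G u' \<inter> hitting W)"
proof -
  have fin: "x * emeasure m (vertex_cyl G u \<inter> hitting H) \<le> y * emeasure m (vertex_cyl G u' \<inter> hitting H)"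
    if H: "finite H" "H \<subseteq> W" for H
  proof -
    have "H \<subseteq> verts G" using H W by blast
    then show ?thesis
      using H le by (auto simp: emeasure_hitting_finite_set[OF H(1)] sum_distrib_left mult.assoc[symmetric]
        intro!: sum_mono mult_right_mono)
  qed
  show ?thesis
  proof (cases "W = {}")
    case True
    then show ?thesis by (simp add: hitting_def)
  next
    case False
    define H where "H n = from_nat_into W ` {..<n}" for n
    have "countable W" using countable_subset[OF W countable_verts] .
    then have "range (from_nat_into W) = W" by (rule range_from_nat_into[OF False])
    moreover have "(\<Union>n. H n) = range (from_nat_into W)"
      by (auto simp: H_def)
    ultimately have "(\<Union>n. H n) = W" by simp
    then have UN: "vertex_cyl G v \<inter> hitting W = (\<Union>n. vertex_cyl G v \<inter> hitting (H n))" for v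
      by (auto simp: hitting_def)
    have H: "finite (H n)" "H n \<subseteq> W" for n
      using from_nat_into[OF False] by (auto simp: H_def)
    have inc: "incseq (\<lambda>n. vertex_cyl G v \<inter> hitting (H n))" for v
    proof (rule incseq_SucI)
      fix n
      have "H n \<subseteq> H (Suc n)" by (auto simp: H_def)
      then show "vertex_cyl G v \<inter> hitting (H n) \<subseteq> vertex_cyl G v \<inter> hitting (H (Suc n))"
        by (auto simp: hitting_def)
    qed
    have "x * emeasure m (vertex_cyl G u \<inter> hitting W) =
        (SUP n. x * emeasure m (vertex_cyl G u \<inter> hitting (H n)))"
      unfolding UN by (subst SUP_emeasure_incseq[symmetric, OF _ inc]) (auto simp: SUP_mult_left_ennreal)
    also have "\<dots> \<le> y * emeasure m (vertex_cyl G u' \<inter> hitting W)"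
    proof (rule SUP_least)
      fix n
      have "x * emeasure m (vertex_cyl G u \<inter> hitting (H n)) \<le>
          y * emeasure m (vertex_cyl G u' \<inter> hitting (H n))"
        by (rule fin[OF H])
      also have "\<dots> \<le> y * emeasure m (vertex_cyl G u' \<inter> hitting W)"
        unfolding UN by (intro mult_left_mono emeasure_mono) auto
      finally show "x * emeasure m (vertex_cyl G u \<inter> hitting (H n)) \<le>
          y * emeasure m (vertex_cyl G u' \<inter> hitting W)" .
    qed
    finally show ?thesis .
  qed
qed

section \<open>Limits of the Martin kernel\<close>

abbreviation K :: "'v \<Rightarrow> 'v \<Rightarrow> ennreal" where
  "K \<equiv> martin_kernel G F \<beta> v0"

abbreviation mass_ratio :: "'v \<Rightarrow> ennreal" where
  "mass_ratio v \<equiv> emeasure m (vertex_cyl G v) / emeasure m (vertex_cyl G v0)"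

text \<open>
  By definition of the Martin kernel, \<open>c \<le> K v w\<close> says \<open>c * green v0 w \<le> green v w\<close>. The comparison
  of hitting masses turns this into \<open>c * m\<^bsub>v0\<^esub> \<le> m\<^sub>v\<close>, as meeting \<open>W\<close> is no restriction
  up to null sets.
\<close>

lemma mass_ratio_bounds:
  assumes W: "W \<subseteq> verts G" and v: "v \<in> verts G"
    and hit: "AE q in m. \<exists>n. tail G (q n) \<in> W"
  shows "(\<And>w. w \<in> W \<Longrightarrow> c \<le> K v w) \<Longrightarrow> c \<le> mass_ratio v"
    and "(\<And>w. w \<in> W \<Longrightarrow> K v w \<le> c) \<Longrightarrow> mass_ratio v \<le> c"
proof -
  have full: "emeasure m (vertex_cyl G u \<inter> hitting W) = emeasure m (vertex_cyl G u)" for u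
  proof (rule emeasure_eq_AE)
    show "AE q in m. q \<in> vertex_cyl G u \<inter> hitting W \<longleftrightarrow> q \<in> vertex_cyl G u"
      using hit by eventually_elim (auto simp: hitting_def vertex_cyl_def)
  qed measurable
  have v0_pos: "0 < emeasure m (vertex_cyl G v0)" "emeasure m (vertex_cyl G v0) < \<infinity>"
    using emeasure_v0_pos emeasure_vertex_cyl_finite[OF v0] .
  show "c \<le> mass_ratio v" if "\<And>w. w \<in> W \<Longrightarrow> c \<le> K v w"
  proof -
    have "c * green G F \<beta> v0 w \<le> 1 * green G F \<beta> v w" if "w \<in> W" for w
      using \<open>\<And>w. w \<in> W \<Longrightarrow> c \<le> K v w\<close>[OF that] W that green_pos[of w] green_finite[of w]
      by (auto simp: martin_kernel_def ennreal_divide_le_iff(2))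
    from emeasure_hitting_mono[OF W this] show ?thesis
      by (simp add: full ennreal_divide_le_iff(2)[OF v0_pos])
  qed
  show "mass_ratio v \<le> c" if "\<And>w. w \<in> W \<Longrightarrow> K v w \<le> c"
  proof -
    have "1 * green G F \<beta> v w \<le> c * green G F \<beta> v0 w" if "w \<in> W" for w
      using \<open>\<And>w. w \<in> W \<Longrightarrow> K v w \<le> c\<close>[OF that] W that green_pos[of w] green_finite[of w]
      by (auto simp: martin_kernel_def ennreal_divide_le_iff(1))
    from emeasure_hitting_mono[OF W this] show ?thesis
      by (simp add: full ennreal_divide_le_iff(1)[OF v0_pos])
  qed
qed

text \<open>
  If \<open>c < L\<close>, almost every path meets \<open>{w. c < K v w}\<close>, so \<open>c \<le> mass_ratio v\<close>; symmetrically for \<open>c > L\<close>.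
\<close>

lemma constant_limit_eq_mass_ratio:
  assumes v: "v \<in> verts G" and lim: "AE q in m. (\<lambda>k. K v (tail G (q k))) \<longlonglongrightarrow> L"
  shows "L = mass_ratio v"
proof (rule antisym)
  have hit: "AE q in m. \<exists>n. tail G (q n) \<in> {w \<in> verts G. R (K v w)}"
    if R: "\<And>f. f \<longlonglongrightarrow> L \<Longrightarrow> \<forall>\<^sub>F k in sequentially. R (f k)" for R
    using lim AE_space
  proof eventually_elim
    fix q assume q: "(\<lambda>k. K v (tail G (q k))) \<longlonglongrightarrow> L" "q \<in> space m"
    obtain k where "R (K v (tail G (q k)))"
      using eventually_happens[OF R[OF q(1)]] by auto
    then show "\<exists>n. tail G (q n) \<in> {w \<in> verts G. R (K v w)}"
      using q(2) inf_paths_tail[of q k] by (auto simp: space_m)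
  qed
  show "L \<le> mass_ratio v"
  proof (rule dense_le)
    fix c assume "c < L"
    show "c \<le> mass_ratio v"
      by (rule mass_ratio_bounds(1)[OF _ v hit[of "\<lambda>x. c < x"]])
        (use \<open>c < L\<close> in \<open>auto intro: order_tendstoD less_imp_le\<close>)
  qed
  show "mass_ratio v \<le> L"
  proof (rule dense_ge)
    fix c assume "L < c"
    show "mass_ratio v \<le> c"
      by (rule mass_ratio_bounds(2)[OF _ v hit[of "\<lambda>x. x < c"]])
        (use \<open>L < c\<close> in \<open>auto intro: order_tendstoD less_imp_le\<close>)
  qed
qed

text \<open>
  Visiting \<open>W\<close> infinitely often is a shift-invariant event. If it had full measure, almost every
  path would meet \<open>W\<close>.
\<close>

lemma ergodic_AE_avoids:
  assumes erg: "shift_ergodic G m"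
    and not_hit: "\<not> (AE q in m. \<exists>n. tail G (q n) \<in> W)"
  shows "AE q in m. \<forall>\<^sub>F n in sequentially. tail G (q n) \<notin> W"
proof -
  let ?D = "{q \<in> space m. \<forall>N. \<exists>n\<ge>N. tail G (q n) \<in> W}"
  have D: "?D \<in> sets m" by measurable
  have "(\<forall>N. \<exists>n\<ge>N. tail G (path_shift q n) \<in> W) \<longleftrightarrow> (\<forall>N. \<exists>n\<ge>N. tail G (q n) \<in> W)" for q
    unfolding path_shift_apply by (metis Suc_le_D Suc_le_mono le_SucI)
  then have "path_shift -` ?D \<inter> inf_paths G = ?D"
    using path_shift_inf_paths by auto
  then consider "emeasure m ?D = 0" | "emeasure m (inf_paths G - ?D) = 0"
    using erg D unfolding shift_ergodic_def sets_m by blast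
  then show ?thesis
  proof cases
    case 1
    then have "AE q in m. q \<notin> ?D"
      using D by (intro AE_not_in null_setsI)
    then show ?thesis
      using AE_space by eventually_elim (auto simp: eventually_sequentially)
  next
    case 2
    have "inf_paths G - ?D \<in> sets m" using sets.compl_sets[OF D] by simp
    with 2 have "AE q in m. q \<notin> inf_paths G - ?D"
      by (intro AE_not_in null_setsI)
    then have "AE q in m. \<exists>n. tail G (q n) \<in> W"
      using AE_space by eventually_elim auto
    with not_hit show ?thesis by contradiction
  qed
qed

text \<open>
  For \<open>c > mass_ratio v\<close> not almost every path can meet \<open>{w. c \<le> K v w}\<close>, so almost every path
  eventually avoids this set; symmetrically below. Rational thresholds \<open>c\<close> suffice.
\<close>

lemma ergodic_AE_limit:
  assumes erg: "shift_ergodic G m" and v: "v \<in> verts G"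
  shows "AE q in m. (\<lambda>k. K v (tail G (q k))) \<longlonglongrightarrow> mass_ratio v"
proof -
  have upper: "AE q in m. \<forall>\<^sub>F k in sequentially. K v (tail G (q k)) < c" if c: "mass_ratio v < c" for c
  proof -
    let ?W = "{w \<in> verts G. c \<le> K v w}"
    have "\<not> (AE q in m. \<exists>n. tail G (q n) \<in> ?W)"
    proof
      assume hit: "AE q in m. \<exists>n. tail G (q n) \<in> ?W"
      have "c \<le> mass_ratio v" by (rule mass_ratio_bounds(1)[OF _ v hit]) auto
      with c show False by simp
    qed
    from ergodic_AE_avoids[OF erg this] AE_space show ?thesis
      by eventually_elim (auto simp: inf_paths_tail not_le elim: eventually_mono)
  qed
  have lower: "AE q in m. \<forall>\<^sub>F k in sequentially. c < K v (tail G (q k))" if c: "c < mass_ratio v" for c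
  proof -
    let ?W = "{w \<in> verts G. K v w \<le> c}"
    have "\<not> (AE q in m. \<exists>n. tail G (q n) \<in> ?W)"
    proof
      assume hit: "AE q in m. \<exists>n. tail G (q n) \<in> ?W"
      have "mass_ratio v \<le> c" by (rule mass_ratio_bounds(2)[OF _ v hit]) auto
      with c show False by simp
    qed
    from ergodic_AE_avoids[OF erg this] AE_space show ?thesis
      by eventually_elim (auto simp: inf_paths_tail not_le elim: eventually_mono)
  qed
  let ?r = "\<lambda>r :: rat. ennreal (real_of_rat r)"
  have "AE q in m. \<forall>r. (mass_ratio v < ?r r \<longrightarrow> (\<forall>\<^sub>F k in sequentially. K v (tail G (q k)) < ?r r)) \<and>
      (?r r < mass_ratio v \<longrightarrow> (\<forall>\<^sub>F k in sequentially. ?r r < K v (tail G (q k))))"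
    unfolding AE_all_countable using upper lower by (auto intro!: AE_conjI)
  then show ?thesis
  proof eventually_elim
    fix q assume q: "\<forall>r. (mass_ratio v < ?r r \<longrightarrow> (\<forall>\<^sub>F k in sequentially. K v (tail G (q k)) < ?r r)) \<and>
      (?r r < mass_ratio v \<longrightarrow> (\<forall>\<^sub>F k in sequentially. ?r r < K v (tail G (q k))))"
    show "(\<lambda>k. K v (tail G (q k))) \<longlonglongrightarrow> mass_ratio v"
    proof (rule order_tendstoI)
      fix c assume "c < mass_ratio v"
      then obtain r where "c < ?r r" "?r r < mass_ratio v" using ennreal_rat_dense by blast
      with q have "\<forall>\<^sub>F k in sequentially. ?r r < K v (tail G (q k))" by blast
      then show "\<forall>\<^sub>F k in sequentially. c < K v (tail G (q k))"
        by (rule eventually_mono) (use \<open>c < ?r r\<close> in auto)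
    next
      fix c assume "mass_ratio v < c"
      then obtain r where "mass_ratio v < ?r r" "?r r < c" using ennreal_rat_dense by blast
      with q have "\<forall>\<^sub>F k in sequentially. K v (tail G (q k)) < ?r r" by blast
      then show "\<forall>\<^sub>F k in sequentially. K v (tail G (q k)) < c"
        by (rule eventually_mono) (use \<open>?r r < c\<close> in auto)
    qed
  qed
qed

definition limit_paths :: "(nat \<Rightarrow> 'a) set" where
  "limit_paths = {q \<in> inf_paths G. \<forall>v\<in>verts G. (\<lambda>k. K v (tail G (q k))) \<longlonglongrightarrow> mass_ratio v}"

text \<open>
  Convergence to a given value is equality of the limit superior and the limit inferior with it.
\<close>

lemma limit_paths_sets [measurable]: "limit_paths \<in> sets m"
proof -
  have [measurable]: "(\<lambda>q. K v (tail G (q k))) \<in> borel_measurable m" for v k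
  proof -
    have "(\<lambda>q. tail G (q k)) \<in> measurable m (count_space (verts G))" by measurable
    then show ?thesis by (rule measurable_compose) simp
  qed
  have "limit_paths = {q \<in> space m. \<forall>v\<in>verts G.
      limsup (\<lambda>k. K v (tail G (q k))) = mass_ratio v \<and> liminf (\<lambda>k. K v (tail G (q k))) = mass_ratio v}"
    by (auto simp: limit_paths_def tendsto_iff_Liminf_eq_Limsup)
  also have "\<dots> \<in> sets m"
  proof (rule sets.sets_Collect_countable_All'[OF _ countable_verts])
    fix v
    show "{q \<in> space m. limsup (\<lambda>k. K v (tail G (q k))) = mass_ratio v \<and>
        liminf (\<lambda>k. K v (tail G (q k))) = mass_ratio v} \<in> sets m"
      by measurable
  qed
  finally show ?thesis .
qed

lemma concentrated_on_limit_paths_iff: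
  "concentrated_on m limit_paths \<longleftrightarrow>
    (\<forall>v\<in>verts G. AE q in m. (\<lambda>k. K v (tail G (q k))) \<longlonglongrightarrow> mass_ratio v)"
proof -
  have "concentrated_on m limit_paths \<longleftrightarrow> (AE q in m. q \<in> limit_paths)"
    by (simp add: concentrated_on_iff_AE limit_paths_sets)
  also have "\<dots> \<longleftrightarrow> (AE q in m. \<forall>v\<in>verts G. (\<lambda>k. K v (tail G (q k))) \<longlonglongrightarrow> mass_ratio v)"
    by (rule AE_cong) (simp add: limit_paths_def)
  also have "\<dots> \<longleftrightarrow> (\<forall>v\<in>verts G. AE q in m. (\<lambda>k. K v (tail G (q k))) \<longlonglongrightarrow> mass_ratio v)"
    by (rule AE_ball_countable[OF countable_verts])
  finally show ?thesis .
qed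

end

section \<open>The equivalences\<close>

context transient_conformal_measure
begin

definition ray_paths :: "(nat \<Rightarrow> 'a) \<Rightarrow> (nat \<Rightarrow> 'a) set" where
  "ray_paths p = {q \<in> wandering G. \<forall>v\<in>verts G. \<exists>L.
     (\<lambda>k. K v (tail G (q k))) \<longlonglongrightarrow> L \<and> (\<lambda>k. K v (tail G (p k))) \<longlonglongrightarrow> L}"

text \<open>
  The ray only serves to make the limits independent of the path; which constants they are is
  decided by the measure.
\<close>

lemma limit_paths_if_ray_paths:
  assumes "concentrated_on m (ray_paths p)"
  shows "concentrated_on m limit_paths"
  unfolding concentrated_on_limit_paths_iff
proof
  fix v assume v: "v \<in> verts G"
  let ?L = "lim (\<lambda>k. K v (tail G (p k)))"
  \<comment> \<open>For \<open>q\<close> in the set, \<open>?L\<close> is a limit along \<open>p\<close> and hence the one along \<open>q\<close>.\<close>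
  have lim: "AE q in m. (\<lambda>k. K v (tail G (q k))) \<longlonglongrightarrow> ?L"
    using assms[unfolded concentrated_on_iff_AE, THEN conjunct2]
  proof eventually_elim
    fix q assume "q \<in> ray_paths p"
    then show "(\<lambda>k. K v (tail G (q k))) \<longlonglongrightarrow> ?L"
      using v by (auto simp: ray_paths_def dest: limI)
  qed
  with constant_limit_eq_mass_ratio[OF v lim]
  show "AE q in m. (\<lambda>k. K v (tail G (q k))) \<longlonglongrightarrow> mass_ratio v"
    by simp
qed

lemma wandering_sets [measurable]: "wandering G \<in> sets m"
proof -
  have "wandering G = {q \<in> space m. \<forall>w\<in>verts G. \<exists>N. \<forall>n\<ge>N. \<not> tail G (q n) \<in> {w}}"
    by (auto simp: wandering_iff eventually_sequentially)
  also have "\<dots> \<in> sets m"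
    by (intro sets.sets_Collect_countable_All'[OF _ countable_verts]) measurable
  finally show ?thesis .
qed

text \<open>
  Any single wandering path in \<^const>\<open>limit_paths\<close> supplies the ray.
\<close>

lemma ray_paths_if_limit_paths:
  assumes "concentrated_on m limit_paths"
  shows "\<exists>p\<in>rays G. concentrated_on m (ray_paths p)"
proof -
  have AE: "AE q in m. q \<in> wandering G \<inter> limit_paths"
    using AE_wandering assms[unfolded concentrated_on_iff_AE, THEN conjunct2] by eventually_elim simp
  have "\<exists>q. q \<in> wandering G \<inter> limit_paths"
  proof (rule ccontr)
    assume "\<nexists>q. q \<in> wandering G \<inter> limit_paths"
    then have "AE q in m. False"
      using AE by (auto elim: eventually_mono)
    then have "emeasure m (space m) = 0"
      using AE_iff_null[of m "\<lambda>_. False"] sets.top[of m] by (simp add: null_sets_def)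
    then show False using emeasure_inf_paths by simp
  qed
  then obtain q where q: "q \<in> wandering G" "q \<in> limit_paths" by auto
  obtain p where p: "p \<in> rays G" "\<And>(f :: 'v \<Rightarrow> ennreal) L.
      (\<lambda>k. f (tail G (q k))) \<longlonglongrightarrow> L \<Longrightarrow> (\<lambda>k. f (tail G (p k))) \<longlonglongrightarrow> L"
    using ray_along_wandering_path[OF q(1)] by metis
  have lim_p: "(\<lambda>k. K v (tail G (p k))) \<longlonglongrightarrow> mass_ratio v" if "v \<in> verts G" for v
    using p(2)[of "K v" "mass_ratio v"] q(2) that by (simp add: limit_paths_def)
  have "(\<exists>L. (\<lambda>k. K v (tail G (q k))) \<longlonglongrightarrow> L \<and> (\<lambda>k. K v (tail G (p k))) \<longlonglongrightarrow> L) \<longleftrightarrow>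
      (\<lambda>k. K v (tail G (q k))) \<longlonglongrightarrow> mass_ratio v" if "v \<in> verts G" for q v
    using lim_p[OF that] by (metis LIMSEQ_unique)
  then have "ray_paths p = wandering G \<inter> limit_paths"
    unfolding ray_paths_def limit_paths_def wandering_def by auto
  then have "concentrated_on m (ray_paths p)"
    using AE wandering_sets limit_paths_sets by (simp add: concentrated_on_iff_AE)
  with p(1) show ?thesis by blast
qed

text \<open>
  A conformal \<open>m' \<le> m\<close> lives on the same paths and hence has the same mass ratios as \<open>m\<close>.
\<close>

lemma extremal_if_limit_paths:
  assumes b: "concentrated_on m limit_paths"
  shows "extremal_conformal G F \<beta> m"
  unfolding extremal_conformal_def
proof (intro conjI allI impI)
  fix m' assume m': "conformal G F \<beta> m' \<and> (\<forall>B\<in>sets (path_borel G). emeasure m' B \<le> emeasure m B)"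
  interpret m': transient_conformal_measure G F \<beta> m' v0
    using m' v0 green_pos green_finite by unfold_locales auto
  let ?c = "emeasure m' (vertex_cyl G v0) / emeasure m (vertex_cyl G v0)"
  have v0_m: "0 < emeasure m (vertex_cyl G v0)" "emeasure m (vertex_cyl G v0) < \<infinity>"
    using emeasure_v0_pos emeasure_vertex_cyl_finite[OF v0] .
  have v0_m': "0 < emeasure m' (vertex_cyl G v0)" "emeasure m' (vertex_cyl G v0) < \<infinity>"
    using m'.emeasure_v0_pos m'.emeasure_vertex_cyl_finite[OF v0] .
  have "?c \<noteq> top"
    using v0_m v0_m' by (auto simp: ennreal_divide_eq_top_iff)
  then have c: "0 < ?c" "?c < \<infinity>"
    using v0_m v0_m' by (auto simp: ennreal_zero_less_divide top.not_eq_extremum)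
  have AE_m': "AE q in m'. q \<in> limit_paths"
  proof (rule AE_I)
    show "{q \<in> space m'. q \<notin> limit_paths} \<subseteq> inf_paths G - limit_paths" by auto
    have X: "inf_paths G - limit_paths \<in> sets m"
      using sets.compl_sets[OF limit_paths_sets] by simp
    then show "inf_paths G - limit_paths \<in> sets m'" by (simp add: sets_m m'.sets_m)
    have "emeasure m' (inf_paths G - limit_paths) \<le> emeasure m (inf_paths G - limit_paths)"
      using m' X by (simp add: sets_m)
    then show "emeasure m' (inf_paths G - limit_paths) = 0"
      using b by (simp add: concentrated_on_def)
  qed
  have "emeasure m' (vertex_cyl G v) = ?c * emeasure m (vertex_cyl G v)" if v: "v \<in> verts G" for v
  proof -
    have "AE q in m'. (\<lambda>k. K v (tail G (q k))) \<longlonglongrightarrow> mass_ratio v"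
      using AE_m' v by (auto simp: limit_paths_def elim: eventually_mono)
    then have "mass_ratio v = m'.mass_ratio v"
      by (rule m'.constant_limit_eq_mass_ratio[OF v])
    then have "emeasure m' (vertex_cyl G v) = mass_ratio v * emeasure m' (vertex_cyl G v0)"
      using v0_m' by (simp add: ennreal_divide_times)
    then show ?thesis
      by (metis ennreal_divide_times mult.commute)
  qed
  then have "m' = scale_measure ?c m"
    by (intro conformal_eq_scaleI m'.conformal_measure_axioms) auto
  moreover have "ennreal (enn2real ?c) = ?c" "0 < enn2real ?c"
    using c by (auto simp: enn2real_positive_iff less_top)
  ultimately show "\<exists>c::real. c > 0 \<and> m' = scale_measure (ennreal c) m"
    by metis
qed (rule conformal)

end

theorem theorem4p15:
  fixes G :: "('v, 'a) pre_digraph"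
    and F :: "'a \<Rightarrow> real"
    and \<beta> :: real
    and v0 :: 'v
    and m :: "(nat \<Rightarrow> 'a) measure"
  assumes "wf_digraph G"
    and "countable (verts G)"
    and "countable (arcs G)"
    and "v0 \<in> verts G"
    and "\<forall>v\<in>verts G. 0 < (\<Sum>n. arrow_matrix_pow G F \<beta> n v0 v) \<and>
                      (\<Sum>n. arrow_matrix_pow G F \<beta> n v0 v) < \<infinity>"
    and "conformal G F \<beta> m"
  defines "a \<equiv> \<exists>p\<in>rays G. concentrated_on m
             {q \<in> wandering G. \<forall>v\<in>verts G. \<exists>L.
                (\<lambda>k. martin_kernel G F \<beta> v0 v (tail G (q k))) \<longlonglongrightarrow> L \<and>
                (\<lambda>k. martin_kernel G F \<beta> v0 v (tail G (p k))) \<longlonglongrightarrow> L}"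
    and "b \<equiv> concentrated_on m
             {q \<in> inf_paths G. \<forall>v\<in>verts G.
                (\<lambda>k. martin_kernel G F \<beta> v0 v (tail G (q k)))
                  \<longlonglongrightarrow> emeasure m (vertex_cyl G v) / emeasure m (vertex_cyl G v0)}"
    and "c \<equiv> extremal_conformal G F \<beta> m"
    and "d \<equiv> shift_ergodic G m"
  shows "(a \<longleftrightarrow> b) \<and> (b \<longleftrightarrow> c) \<and> (c \<longleftrightarrow> d)"
proof -
  interpret wf_digraph G by fact
  interpret transient_conformal_measure G F \<beta> m v0
    using assms(2-6) by unfold_locales (auto simp: green_def)
  have a_def': "a \<longleftrightarrow> (\<exists>p\<in>rays G. concentrated_on m (ray_paths p))"
    unfolding a_def ray_paths_def ..
  have b_def': "b \<longleftrightarrow> concentrated_on m limit_paths"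
    unfolding b_def limit_paths_def ..
  have "a \<Longrightarrow> b"
    unfolding a_def' b_def' using limit_paths_if_ray_paths by blast
  moreover have "b \<Longrightarrow> a"
    unfolding a_def' b_def' by (rule ray_paths_if_limit_paths)
  moreover have "b \<Longrightarrow> c"
    unfolding b_def' c_def by (rule extremal_if_limit_paths)
  moreover have "c \<Longrightarrow> d"
    unfolding c_def d_def by (rule ergodic_if_extremal)
  moreover have "d \<Longrightarrow> b"
    unfolding b_def' d_def concentrated_on_limit_paths_iff using ergodic_AE_limit by blast
  ultimately show ?thesis by blast
qed

end
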